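(* Let $[H,G]$ be a distributive interval of finite groups. If its dual Euler totient $\hat{\varphi}(H,G)$ is nonzero, then there is an irreducible complex representation $V$ of $G$ such that $G_{(V^H)} = H$.
   Context: An interval of finite groups $[H,G]$ is the lattice of all subgroups $K$ with $H \subseteq K \subseteq G$, ordered by inclusion, where $G$ is a finite group and $H$ a subgroup of $G$; it is called distributive if this lattice is distributive. The dual Euler totient of $[H,G]$ is $\hat{\varphi}(H,G) := \sum_{K \in [H,G]} \mu(H,K)\,|G:K|$, where $\mu$ is the Möbius function of the lattice $[H,G]$. For a representation $V$ of $G$, a subgroup $K \subseteq G$ and a subspace $X \subseteq V$, the fixed-point subspace is $V^K := \{v \in V \mid kv = v \ \forall k \in K\}$ and the pointwise stabilizer is $G_{(X)} := \{g \in G \mid gx = x \ \forall x \in X\}$. *)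

theory Defs
  imports "Jordan_Normal_Form.VS_Connect"
begin

definition subgroup_interval :: "'a set \<Rightarrow> ('a, 'b) monoid_scheme \<Rightarrow> 'a set gorder"
  where "subgroup_interval H G =
    \<lparr>carrier = {K. subgroup K G \<and> H \<subseteq> K}, eq = (=), le = (\<subseteq>)\<rparr>"

definition distributive_lattice :: "('a, 'b) gorder_scheme \<Rightarrow> bool"
  where "distributive_lattice L \<longleftrightarrow> lattice L \<and>
    (\<forall>x\<in>carrier L. \<forall>y\<in>carrier L. \<forall>z\<in>carrier L.
       x \<sqinter>\<^bsub>L\<^esub> (y \<squnion>\<^bsub>L\<^esub> z) = (x \<sqinter>\<^bsub>L\<^esub> y) \<squnion>\<^bsub>L\<^esub> (x \<sqinter>\<^bsub>L\<^esub> z))"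

text \<open>The Moebius function of a finite poset. The value 0 is the usual one when
  \<open>x \<sqsubseteq> y\<close> fails, and a dummy when \<open>L\<close> is not a finite poset or \<open>x\<close> or \<open>y\<close> is not in it.\<close>

function mobius :: "('a, 'b) gorder_scheme \<Rightarrow> 'a \<Rightarrow> 'a \<Rightarrow> int"
  where "mobius L x y =
    (if partial_order L \<and> finite (carrier L) \<and> x \<in> carrier L \<and> y \<in> carrier L \<and> x \<sqsubseteq>\<^bsub>L\<^esub> y
     then if x = y then 1
          else - (\<Sum>z\<in>{z \<in> carrier L. x \<sqsubseteq>\<^bsub>L\<^esub> z \<and> z \<sqsubset>\<^bsub>L\<^esub> y}. mobius L x z)
     else 0)"
  by pat_completeness auto
termination
proof (relation "measure (\<lambda>(L, x, y). card {z \<in> carrier L. z \<sqsubset>\<^bsub>L\<^esub> y})")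
  fix L :: "('a, 'b) gorder_scheme" and x y z
  assume *: "partial_order L \<and> finite (carrier L) \<and> x \<in> carrier L \<and> y \<in> carrier L \<and> x \<sqsubseteq>\<^bsub>L\<^esub> y"
    and "z \<in> {z \<in> carrier L. x \<sqsubseteq>\<^bsub>L\<^esub> z \<and> z \<sqsubset>\<^bsub>L\<^esub> y}"
  then have z: "z \<in> carrier L" "z \<sqsubset>\<^bsub>L\<^esub> y" by auto
  interpret partial_order L using * by blast
  have "w \<sqsubset>\<^bsub>L\<^esub> y" if "w \<in> carrier L" "w \<sqsubset>\<^bsub>L\<^esub> z" for w
    using that z * lless_trans by blast
  moreover have "\<not> z \<sqsubset>\<^bsub>L\<^esub> z"
    using z by (simp add: lless_def)
  ultimately have "{w \<in> carrier L. w \<sqsubset>\<^bsub>L\<^esub> z} \<subset> {w \<in> carrier L. w \<sqsubset>\<^bsub>L\<^esub> y}"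
    using z by blast
  then show "((L, x, z), (L, x, y)) \<in> measure (\<lambda>(L, x, y). card {z \<in> carrier L. z \<sqsubset>\<^bsub>L\<^esub> y})"
    using * by (simp add: psubset_card_mono)
qed auto

declare mobius.simps [simp del]

definition dual_euler_totient :: "'a set \<Rightarrow> ('a, 'b) monoid_scheme \<Rightarrow> int"
  where "dual_euler_totient H G =
    (\<Sum>K\<in>carrier (subgroup_interval H G).
       mobius (subgroup_interval H G) H K * int (card (rcosets\<^bsub>G\<^esub> K)))"

text \<open>A finite-dimensional complex representation of \<open>G\<close> is taken on the space of column
  vectors of length \<open>n\<close>, as a homomorphism \<open>\<rho>\<close> from \<open>G\<close> to the general linear group,
  that is, the unit group of the ring of complex \<open>n \<times> n\<close> matrices.\<close>

definition complex_representation :: "('a, 'b) monoid_scheme \<Rightarrow> nat \<Rightarrow> ('a \<Rightarrow> complex mat) \<Rightarrow> bool"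
  where "complex_representation G n \<rho> \<longleftrightarrow> \<rho> \<in> hom G (units_of (ring_mat TYPE(complex) n ()))"

definition irreducible_complex_representation ::
    "('a, 'b) monoid_scheme \<Rightarrow> nat \<Rightarrow> ('a \<Rightarrow> complex mat) \<Rightarrow> bool"
  where "irreducible_complex_representation G n \<rho> \<longleftrightarrow> complex_representation G n \<rho> \<and> n \<noteq> 0 \<and>
    (\<forall>W. VectorSpace.subspace class_ring W (module_vec TYPE(complex) n) \<and>
         (\<forall>g\<in>carrier G. \<forall>w\<in>W. \<rho> g *\<^sub>v w \<in> W)
       \<longrightarrow> W = {0\<^sub>v n} \<or> W = carrier_vec n)"

definition fixed_point_subspace :: "nat \<Rightarrow> ('a \<Rightarrow> complex mat) \<Rightarrow> 'a set \<Rightarrow> complex vec set"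
  where "fixed_point_subspace n \<rho> K = {v \<in> carrier_vec n. \<forall>k\<in>K. \<rho> k *\<^sub>v v = v}"

definition pointwise_stabilizer ::
    "('a, 'b) monoid_scheme \<Rightarrow> ('a \<Rightarrow> complex mat) \<Rightarrow> complex vec set \<Rightarrow> 'a set"
  where "pointwise_stabilizer G \<rho> X = {g \<in> carrier G. \<forall>x\<in>X. \<rho> g *\<^sub>v x = x}"

end

theory Submission
  imports Defs "Jordan_Normal_Form.DL_Rank"
begin

text \<open>Write \<open>a \<chi>\<close> for the sum over \<open>K\<close> in \<open>[H, G]\<close> of \<open>\<mu>(H, K)\<close> times the average of \<open>\<chi>\<close> over
  \<open>K\<close>. For the character of a representation \<open>V\<close>, that average is the dimension of \<open>V\<^sup>K\<close>, so
  \<open>a\<close> maps the character of the regular representation to the dual Euler totient. Since \<open>a\<close>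
  is additive and a character splits along an invariant subspace, \<open>a\<close> is nonzero at the
  character of some irreducible \<open>V\<close>. If \<open>M\<close>, the pointwise stabilizer of \<open>V\<^sup>H\<close>, were different
  from \<open>H\<close>, then \<open>V\<^sup>K = V\<^bsup>K \<or> M\<^esup>\<close> for every \<open>K\<close> in the interval, and Weisner's theorem
  would give \<open>a = 0\<close> at the character of \<open>V\<close>.\<close>

section \<open>Weisner's theorem\<close>

text \<open>Since \<open>f x = f (x \<squnion> a)\<close>, the sum can be grouped by the value
  \<open>y = x \<squnion> a\<close>, and \<open>f y\<close> factors out of each group. What remains
  of a group is the sum \<open>S y\<close> of Moebius values, which vanishes because
  \<open>a\<close> differs from the bottom element \<open>b\<close>.\<close>

lemma (in lattice) weisner:
  fixes f :: "'a \<Rightarrow> 'c::comm_ring_1"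
  assumes fin: "finite (carrier L)"
    and b: "b \<in> carrier L" "\<And>x. x \<in> carrier L \<Longrightarrow> b \<sqsubseteq> x"
    and a: "a \<in> carrier L" "a \<noteq> b"
    and f: "\<And>x. x \<in> carrier L \<Longrightarrow> f (x \<squnion> a) = f x"
  shows "(\<Sum>x\<in>carrier L. of_int (mobius L b x) * f x) = 0"
proof -
  define S where "S y = (\<Sum>x\<in>{x \<in> carrier L. x \<squnion> a = y}. mobius L b x)" for y
  have po: "partial_order L" ..
  \<comment> \<open>This is the recursion for \<open>mobius\<close> with all terms on one side. The
    recursion only ranges over elements above \<open>b\<close>, which here means all
    elements.\<close>
  have below: "(\<Sum>x\<in>{x \<in> carrier L. x \<sqsubseteq> y}. mobius L b x) = 0"
    if y: "y \<in> carrier L" "y \<noteq> b" for y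
  proof -
    have "{x \<in> carrier L. x \<sqsubseteq> y} = insert y {x \<in> carrier L. b \<sqsubseteq> x \<and> x \<sqsubset> y}"
      using y b by (auto simp: lless_def eq_is_equal)
    moreover have "mobius L b y = - (\<Sum>x\<in>{x \<in> carrier L. b \<sqsubseteq> x \<and> x \<sqsubset> y}. mobius L b x)"
      by (subst mobius.simps) (use y b fin po in auto)
    ultimately show ?thesis
      using fin by (simp add: lless_def eq_is_equal)
  qed
  \<comment> \<open>If \<open>a\<close> is not below \<open>y\<close>, the group of \<open>y\<close>
    is empty. Otherwise the zero sum over all \<open>x \<sqsubseteq> y\<close> regroups into the
    sums \<open>S z\<close> with \<open>z \<sqsubseteq> y\<close>, because
    \<open>x \<squnion> a\<close> stays below \<open>y\<close>. By induction on the number of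
    elements strictly below \<open>y\<close>, only \<open>S y\<close> is left.\<close>
  have S0: "S y = 0" if "y \<in> carrier L" for y
    using that
  proof (induction "card {z \<in> carrier L. z \<sqsubset> y}" arbitrary: y rule: less_induct)
    case less
    show ?case
    proof (cases "a \<sqsubseteq> y")
      case False
      then have "{x \<in> carrier L. x \<squnion> a = y} = {}"
        using a join_right by auto
      then show ?thesis by (simp only: S_def sum.empty)
    next
      case True
      with a b less.prems have "y \<noteq> b"
        using le_antisym by blast
      have IH: "S z = 0" if z: "z \<in> carrier L" "z \<sqsubset> y" for z
      proof (rule less.hyps[OF _ z(1)], rule psubset_card_mono)
        have "w \<sqsubset> y" if "w \<in> carrier L" "w \<sqsubset> z" for w
          using that z less.prems lless_trans by blast
        moreover have "\<not> z \<sqsubset> z" by (simp add: lless_def eq_is_equal)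
        ultimately show "{w \<in> carrier L. w \<sqsubset> z} \<subset> {w \<in> carrier L. w \<sqsubset> y}"
          using z by blast
      qed (use fin in auto)
      have "0 = (\<Sum>x\<in>{x \<in> carrier L. x \<sqsubseteq> y}. mobius L b x)"
        using below less.prems \<open>y \<noteq> b\<close> by simp
      also have "\<dots> = (\<Sum>z\<in>{z \<in> carrier L. z \<sqsubseteq> y}.
          \<Sum>x\<in>{x \<in> {x \<in> carrier L. x \<sqsubseteq> y}. x \<squnion> a = z}. mobius L b x)"
        by (rule sum.group[symmetric])
          (use fin a less.prems True in \<open>auto intro: join_le\<close>)
      also have "\<dots> = (\<Sum>z\<in>{z \<in> carrier L. z \<sqsubseteq> y}. S z)"
        unfolding S_def
      proof (rule sum.cong[OF HOL.refl], rule sum.cong[OF _ HOL.refl])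
        fix z assume "z \<in> {z \<in> carrier L. z \<sqsubseteq> y}"
        then show "{x \<in> {x \<in> carrier L. x \<sqsubseteq> y}. x \<squnion> a = z} = {x \<in> carrier L. x \<squnion> a = z}"
          using a less.prems join_left le_trans by blast
      qed
      also have "\<dots> = (\<Sum>z\<in>insert y {z \<in> carrier L. z \<sqsubset> y}. S z)"
        by (rule sum.cong) (use less.prems in \<open>auto simp: lless_def eq_is_equal\<close>)
      also have "\<dots> = S y"
        using fin IH by (subst sum.insert) (auto simp: lless_def eq_is_equal)
      finally show ?thesis by simp
    qed
  qed
  have "(\<Sum>x\<in>carrier L. of_int (mobius L b x) * f x)
      = (\<Sum>y\<in>carrier L. \<Sum>x\<in>{x \<in> carrier L. x \<squnion> a = y}. of_int (mobius L b x) * f x)"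
    by (rule sum.group[symmetric]) (use fin a in auto)
  also have "\<dots> = (\<Sum>y\<in>carrier L. of_int (S y) * f y)"
    unfolding S_def of_int_sum sum_distrib_right
    by (intro sum.cong refl) (use f in auto)
  finally show ?thesis by (simp add: S0)
qed

section \<open>Traces and bases adapted to a subspace\<close>

definition trace :: "'a::comm_monoid_add mat \<Rightarrow> 'a"
  where "trace A = (\<Sum>i<dim_row A. A $$ (i, i))"

lemma trace_mult_commute:
  fixes A B :: "'a::comm_semiring_0 mat"
  assumes "A \<in> carrier_mat n m" "B \<in> carrier_mat m n"
  shows "trace (A * B) = trace (B * A)"
proof -
  have "trace (A * B) = (\<Sum>i<n. \<Sum>j<m. A $$ (i, j) * B $$ (j, i))"
    using assms by (simp add: trace_def scalar_prod_def lessThan_atLeast0)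
  also have "\<dots> = (\<Sum>j<m. \<Sum>i<n. B $$ (j, i) * A $$ (i, j))"
    by (subst sum.swap) (simp add: mult.commute)
  also have "\<dots> = trace (B * A)"
    using assms by (simp add: trace_def scalar_prod_def lessThan_atLeast0)
  finally show ?thesis .
qed

text \<open>The columns of \<open>P\<close> are a basis of the whole space whose first
  \<open>m\<close> members are a basis of \<open>W\<close>. Its inverse \<open>Q\<close> reads off
  coordinates, so \<open>W\<close> is cut out by the vanishing of those from \<open>m\<close> on. In
  this form, invariance of \<open>W\<close> becomes a block of zeros in a matrix.\<close>

lemma (in vec_space) ex_adapted_basis:
  assumes W: "VectorSpace.subspace class_ring W V"
  obtains m P Q where "m \<le> n" "P \<in> carrier_mat n n" "Q \<in> carrier_mat n n"
    "P * Q = 1\<^sub>m n" "Q * P = 1\<^sub>m n"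
    "\<And>v. v \<in> W \<longleftrightarrow> v \<in> carrier_vec n \<and> (\<forall>i. m \<le> i \<and> i < n \<longrightarrow> (Q *\<^sub>v v) $ i = 0)"
proof -
  have WV: "W \<subseteq> carrier_vec n" and subW: "submodule class_ring W V"
    using W by (auto simp: VectorSpace.subspace_def submodule_def)
  have card_le: "finite T \<and> card T \<le> n" if "T \<subseteq> carrier_vec n" "lin_indpt T" for T
    using li_le_dim[of T] that dim_is_n by auto
  have indpt_Un: "lin_indpt (T \<union> {v})"
    if "T \<subseteq> carrier_vec n" "lin_indpt T" "v \<in> carrier_vec n" "v \<notin> span T" for T v
    using lin_dep_iff_in_span[of T v] span_mem[of T v] that by auto
  have lin_indpt_empty: "lin_indpt {}"
    by (auto simp: lin_dep_def)
  \<comment> \<open>Independent sets have at most \<open>n\<close> elements, so a maximal one inside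
    \<open>W\<close> exists; the empty set shows that there is one at all.\<close>
  obtain B where finB: "finite B" and maxB: "maximal B (\<lambda>T. T \<subseteq> W \<and> lin_indpt T)"
  proof -
    have "finite T \<and> card T \<le> n" if "T \<subseteq> W \<and> lin_indpt T" for T
      using card_le[of T] that WV by (meson subset_trans)
    from maximal_exists[where P = "\<lambda>T. T \<subseteq> W \<and> lin_indpt T", OF this, of "{}"]
    show ?thesis
      using that lin_indpt_empty by (metis empty_subsetI)
  qed
  from maxB have BW: "B \<subseteq> W" and indB: "lin_indpt B"
    by (auto simp: maximal_def)
  have span_B: "span B = W"
  proof
    show "span B \<subseteq> W"
      using span_is_subset[OF BW subW] .
    show "W \<subseteq> span B"
    proof
      fix w assume w: "w \<in> W"
      show "w \<in> span B"
      proof (rule ccontr)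
        assume *: "w \<notin> span B"
        then have "lin_indpt (B \<union> {w})"
          using indpt_Un indB BW WV w by blast
        moreover have "\<forall>T. B \<subseteq> T \<and> (T \<subseteq> W \<and> lin_indpt T) \<longrightarrow> T = B"
          using maxB unfolding maximal_def by metis
        ultimately have "B \<union> {w} = B"
          using BW w by (metis Un_upper1 Un_least empty_subsetI insert_subset)
        then have "w \<in> span B"
          using span_mem[OF subset_trans[OF BW WV]] by blast
        with * show False ..
      qed
    qed
  qed
  \<comment> \<open>The basis \<open>B\<close> of \<open>W\<close> is extended by maximality among
    the independent sets containing \<open>B\<close>. The result is maximal among all independent
    sets, since any larger set contains \<open>B\<close> too.\<close>
  obtain C where finC: "finite C"
    and maxC: "maximal C (\<lambda>T. B \<subseteq> T \<and> T \<subseteq> carrier_vec n \<and> lin_indpt T)"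
  proof -
    have "finite T \<and> card T \<le> n" if "B \<subseteq> T \<and> T \<subseteq> carrier_vec n \<and> lin_indpt T" for T
      using card_le[of T] that by simp
    from maximal_exists[where P = "\<lambda>T. B \<subseteq> T \<and> T \<subseteq> carrier_vec n \<and> lin_indpt T", OF this, of B]
    have "\<exists>C. finite C \<and> maximal C (\<lambda>T. B \<subseteq> T \<and> T \<subseteq> carrier_vec n \<and> lin_indpt T)"
      using subset_trans[OF BW WV] indB by simp
    then show ?thesis
      using that by (elim exE conjE)
  qed
  then have BC: "B \<subseteq> C"
    by (simp add: maximal_def)
  with maxC have "maximal C (\<lambda>T. T \<subseteq> carrier_vec n \<and> lin_indpt T)"
    unfolding maximal_def by (meson subset_trans)
  then have "basis C"
    using max_li_is_basis by simp
  then have C: "C \<subseteq> carrier_vec n" "lin_indpt C" "card C = n"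
    using dim_basis[OF finC] dim_is_n by (auto simp: basis_def)
  \<comment> \<open>Listing \<open>B\<close> before \<open>C - B\<close> makes the columns that lie
    in \<open>W\<close> exactly those of index below \<open>length bs\<close>.\<close>
  obtain bs cs where bs: "set bs = B" "distinct bs" and cs: "set cs = C - B" "distinct cs"
    using finite_distinct_list finB finC by (metis finite_Diff)
  define P where "P = mat_of_cols n (bs @ cs)"
  have set_bcs: "set (bs @ cs) = C" "distinct (bs @ cs)"
    using bs cs BC by auto
  then have len: "length (bs @ cs) = n"
    using C distinct_card by metis
  have P: "P \<in> carrier_mat n n"
    using mat_of_cols_carrier(1)[of n "bs @ cs"] len by (simp only: P_def)
  have colsP: "cols P = bs @ cs"
    unfolding P_def using C set_bcs by (intro cols_mat_of_cols) auto
  have "rank P = n"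
    using lin_indpt_full_rank[OF P] colsP set_bcs C by metis
  then have "det P \<noteq> 0"
    using det_rank_iff[OF P] by simp
  from det_non_zero_imp_unit[OF P this, of "()"]
  obtain Q where Q: "Q \<in> carrier_mat n n" "P * Q = 1\<^sub>m n" "Q * P = 1\<^sub>m n"
    by (auto simp: Units_def ring_mat_def)
  have lincomb_C: "lincomb a C = lincomb a B" if "\<And>x. x \<in> C - B \<Longrightarrow> a x = 0" for a
  proof -
    have "lincomb a (C - B) = 0\<^sub>v n"
      using C that by (intro lincomb_zero) auto
    moreover have "lincomb a B \<in> carrier_vec n"
      using BW WV finB by (intro lincomb_closed) auto
    ultimately show ?thesis
      using lincomb_vec_diff_add[OF C(1) BC finC, of a] by simp
  qed
  have col_P: "col P i = (bs @ cs) ! i" if "i < n" for i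
    using cols_nth[of i P] colsP that P by simp
  have nth_P: "col P i \<in> C - B \<longleftrightarrow> length bs \<le> i" if "i < n" for i
  proof (cases "i < length bs")
    case True
    then show ?thesis
      using nth_mem[OF True] bs(1) by (simp add: col_P[OF that] nth_append)
  next
    case False
    then have "i - length bs < length cs"
      using len that by simp
    from nth_mem[OF this] False show ?thesis
      using cs(1) by (simp add: col_P[OF that] nth_append)
  qed
  have mem: "P *\<^sub>v c \<in> W"
    if c: "c \<in> carrier_vec n" "\<forall>i. length bs \<le> i \<and> i < n \<longrightarrow> c $ i = 0" for c
  proof -
    \<comment> \<open>Coordinates are indexed by positions, coefficients of \<open>lincomb\<close>
      by vectors. As the columns are distinct, \<open>find_first\<close> recovers the position of a
      vector.\<close>
    let ?a = "\<lambda>x. c $ find_first x (cols P)"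
    have "?a x = 0" if x: "x \<in> C - B" for x
    proof -
      obtain i where i: "i < n" "x = (bs @ cs) ! i"
        using x set_bcs len by (metis DiffD1 in_set_conv_nth)
      then have "length bs \<le> i"
        using nth_P[OF i(1)] col_P[OF i(1)] x by simp
      moreover have "find_first x (cols P) = i"
        using i set_bcs len colsP by (simp add: find_first_unique)
      ultimately show ?thesis using c i by simp
    qed
    then have "P *\<^sub>v c = lincomb ?a B"
      using lincomb_eq_mat_mult[OF P c(1)] lincomb_C[of ?a] colsP set_bcs by metis
    then show ?thesis
      using span_B finB unfolding span_def by auto
  qed
  have mem_rev: "\<exists>c\<in>carrier_vec n. v = P *\<^sub>v c \<and> (\<forall>i. length bs \<le> i \<and> i < n \<longrightarrow> c $ i = 0)"
    if v: "v \<in> W" for v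
  proof -
    obtain a where a: "lincomb a B = v"
      using finite_in_span[of B v] v span_B finB BW WV by auto
    \<comment> \<open>Extending the coefficients by zero from \<open>B\<close> to \<open>C\<close>
      yields a coordinate vector whose entries from \<open>length bs\<close> on vanish.\<close>
    define b where "b x = (if x \<in> B then a x else 0)" for x
    have "lincomb b B = lincomb a B"
      using BW WV finB by (intro lincomb_cong) (auto simp: b_def)
    then have "P *\<^sub>v vec n (\<lambda>i. b (col P i)) = v"
      using mat_mult_eq_lincomb[OF P, of b] lincomb_C[of b] colsP set_bcs a by (simp add: b_def)
    then show ?thesis
      using nth_P by (intro bexI[of _ "vec n (\<lambda>i. b (col P i))"]) (auto simp: b_def)
  qed
  show ?thesis
  proof (rule that[of "length bs" P Q])
    fix v
    show "v \<in> W \<longleftrightarrow> v \<in> carrier_vec n \<and> (\<forall>i. length bs \<le> i \<and> i < n \<longrightarrow> (Q *\<^sub>v v) $ i = 0)"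
    proof
      assume "v \<in> W"
      with mem_rev obtain c where c: "c \<in> carrier_vec n" "v = P *\<^sub>v c"
        "\<forall>i. length bs \<le> i \<and> i < n \<longrightarrow> c $ i = 0" by blast
      then have "Q *\<^sub>v v = c"
        using P Q by (metis assoc_mult_mat_vec one_mult_mat_vec)
      with c P show "v \<in> carrier_vec n \<and> (\<forall>i. length bs \<le> i \<and> i < n \<longrightarrow> (Q *\<^sub>v v) $ i = 0)"
        by simp
    next
      assume v: "v \<in> carrier_vec n \<and> (\<forall>i. length bs \<le> i \<and> i < n \<longrightarrow> (Q *\<^sub>v v) $ i = 0)"
      then have "P *\<^sub>v (Q *\<^sub>v v) = v"
        using P Q by (metis assoc_mult_mat_vec one_mult_mat_vec)
      with mem[of "Q *\<^sub>v v"] v Q show "v \<in> W" by simp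
    qed
  qed (use len P Q in auto)
qed

lemma index_mult_mat_sum:
  assumes "A \<in> carrier_mat n m" "B \<in> carrier_mat m p" "i < n" "j < p"
  shows "(A * B) $$ (i, j) = (\<Sum>l<m. A $$ (i, l) * B $$ (l, j))"
  using assms by (auto simp: scalar_prod_def lessThan_atLeast0)

section \<open>Averages over subgroups and fixed points\<close>

text \<open>For a subgroup \<open>K\<close> and a representation \<open>\<rho>\<close>, this is the
  projection onto the vectors fixed by \<open>K\<close>. It is given entrywise, so that it is an
  \<open>n\<close> by \<open>n\<close> matrix whatever \<open>\<rho>\<close> and \<open>K\<close>
  are.\<close>

definition average :: "nat \<Rightarrow> ('a \<Rightarrow> complex mat) \<Rightarrow> 'a set \<Rightarrow> complex mat"
  where "average n \<rho> K = mat n n (\<lambda>ij. (\<Sum>k\<in>K. \<rho> k $$ ij) / of_nat (card K))"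

lemma average_carrier [simp]: "average n \<rho> K \<in> carrier_mat n n"
  by (simp add: average_def)

lemma trace_average:
  assumes "\<And>k. k \<in> K \<Longrightarrow> \<rho> k \<in> carrier_mat n n"
  shows "trace (average n \<rho> K) = (\<Sum>k\<in>K. trace (\<rho> k)) / of_nat (card K)"
proof -
  have "trace (average n \<rho> K) = (\<Sum>i<n. \<Sum>k\<in>K. \<rho> k $$ (i, i)) / of_nat (card K)"
    by (simp add: trace_def average_def sum_divide_distrib)
  also have "(\<Sum>i<n. \<Sum>k\<in>K. \<rho> k $$ (i, i)) = (\<Sum>k\<in>K. trace (\<rho> k))"
    by (subst sum.swap) (use assms in \<open>auto simp: trace_def intro!: sum.cong\<close>)
  finally show ?thesis .
qed

text \<open>The product is an average of the matrices \<open>\<rho> k * X\<close>, all equal to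
  \<open>X\<close>. It is stated for matrices rather than vectors because \<open>X\<close> will
  itself be an average.\<close>

lemma average_mult_fixed:
  assumes "finite K" "K \<noteq> {}" and \<rho>: "\<And>k. k \<in> K \<Longrightarrow> \<rho> k \<in> carrier_mat n n"
    and X: "X \<in> carrier_mat n n" and fixed: "\<And>k. k \<in> K \<Longrightarrow> \<rho> k * X = X"
  shows "average n \<rho> K * X = X"
proof (rule eq_matI)
  fix i j assume "i < dim_row X" "j < dim_col X"
  then have ij: "i < n" "j < n" using X by auto
  have "(average n \<rho> K * X) $$ (i, j)
      = (\<Sum>l<n. \<Sum>k\<in>K. \<rho> k $$ (i, l) * X $$ (l, j)) / of_nat (card K)"
    using ij X by (simp add: average_def scalar_prod_def lessThan_atLeast0 sum_divide_distrib
        sum_distrib_right)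
  also have "(\<Sum>l<n. \<Sum>k\<in>K. \<rho> k $$ (i, l) * X $$ (l, j)) = (\<Sum>k\<in>K. (\<rho> k * X) $$ (i, j))"
    by (subst sum.swap, intro sum.cong refl)
      (use index_mult_mat_sum[OF \<rho> X ij] in simp)
  also have "\<dots> / of_nat (card K) = X $$ (i, j)"
    using assms(1,2) fixed by simp
  finally show "(average n \<rho> K * X) $$ (i, j) = X $$ (i, j)" .
qed (use X in \<open>auto simp: average_def\<close>)

text \<open>Invertibility of \<open>\<rho> g\<close> comes for free from the product of
  \<open>\<rho> g\<close> and the image of the inverse of \<open>g\<close>. Later arguments thus
  deal with plain matrix identities instead of the unit group.\<close>

lemma complex_representation_iff:
  assumes "group G"
  shows "complex_representation G n \<rho> \<longleftrightarrow>
    (\<forall>g\<in>carrier G. \<rho> g \<in> carrier_mat n n) \<and> \<rho> \<one>\<^bsub>G\<^esub> = 1\<^sub>m n \<and>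
    (\<forall>g\<in>carrier G. \<forall>h\<in>carrier G. \<rho> (g \<otimes>\<^bsub>G\<^esub> h) = \<rho> g * \<rho> h)"
  (is "_ \<longleftrightarrow> ?R")
proof -
  interpret G: group G by fact
  interpret M: ring "ring_mat TYPE(complex) n ()" by (rule ring_mat)
  let ?U = "units_of (ring_mat TYPE(complex) n ())"
  interpret U: group ?U by (rule M.units_group)
  show ?thesis
  proof
    assume "complex_representation G n \<rho>"
    then have hom: "\<rho> \<in> hom G ?U" by (simp add: complex_representation_def)
    then interpret group_hom G ?U \<rho>
      by unfold_locales
    show ?R
      using hom hom_one by (auto simp: hom_def units_of_def Units_def ring_mat_simps)
  next
    assume R: ?R
    have "\<rho> g \<in> Units (ring_mat TYPE(complex) n ())" if g: "g \<in> carrier G" for g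
    proof -
      have "\<rho> (inv\<^bsub>G\<^esub> g) * \<rho> g = 1\<^sub>m n" "\<rho> g * \<rho> (inv\<^bsub>G\<^esub> g) = 1\<^sub>m n"
        using R g G.l_inv G.r_inv G.inv_closed by metis+
      then show ?thesis
        using R g G.inv_closed[OF g] unfolding Units_def by (auto simp: ring_mat_simps)
    qed
    then show "complex_representation G n \<rho>"
      using R by (auto simp: complex_representation_def hom_def units_of_def ring_mat_simps)
  qed
qed

text \<open>Left multiplication by \<open>h\<close> permutes \<open>K\<close>, so it only reorders
  the sum. Hence the columns of the average are fixed by \<open>K\<close>.\<close>

lemma mult_average:
  assumes "group G" "complex_representation G n \<rho>" "subgroup K G" "h \<in> K"
  shows "\<rho> h * average n \<rho> K = average n \<rho> K"
proof -
  interpret G: group G by fact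
  note sub = subgroup.mem_carrier[OF \<open>subgroup K G\<close>]
  have \<rho>: "\<rho> g \<in> carrier_mat n n" "\<rho> (g \<otimes>\<^bsub>G\<^esub> k) = \<rho> g * \<rho> k"
    if "g \<in> carrier G" "k \<in> carrier G" for g k
    using assms that by (auto simp: complex_representation_iff)
  have h: "\<rho> h \<in> carrier_mat n n" using \<rho> sub \<open>h \<in> K\<close> by blast
  show ?thesis
  proof (rule eq_matI)
    fix i j assume "i < dim_row (average n \<rho> K)" "j < dim_col (average n \<rho> K)"
    then have ij: "i < n" "j < n" by (auto simp: average_def)
    have "(\<rho> h * average n \<rho> K) $$ (i, j)
        = (\<Sum>l<n. \<Sum>k\<in>K. \<rho> h $$ (i, l) * \<rho> k $$ (l, j)) / of_nat (card K)"
      using ij h by (simp add: average_def scalar_prod_def lessThan_atLeast0 sum_divide_distrib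
          sum_distrib_left)
    also have "(\<Sum>l<n. \<Sum>k\<in>K. \<rho> h $$ (i, l) * \<rho> k $$ (l, j)) = (\<Sum>k\<in>K. \<rho> (h \<otimes>\<^bsub>G\<^esub> k) $$ (i, j))"
    proof (subst sum.swap, intro sum.cong refl)
      fix k assume "k \<in> K"
      then show "(\<Sum>l<n. \<rho> h $$ (i, l) * \<rho> k $$ (l, j)) = \<rho> (h \<otimes>\<^bsub>G\<^esub> k) $$ (i, j)"
        using index_mult_mat_sum[OF h \<rho>(1) ij, of k k] \<rho>(2)[of h k] sub \<open>h \<in> K\<close> by simp
    qed
    also have "\<dots> = (\<Sum>k\<in>K. \<rho> k $$ (i, j))"
    proof (rule sum.reindex_bij_betw)
      interpret K: group "G\<lparr>carrier := K\<rparr>"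
        using \<open>subgroup K G\<close> by (rule G.subgroup_imp_group)
      show "bij_betw (\<lambda>k. h \<otimes>\<^bsub>G\<^esub> k) K K"
        using K.inj_on_multc K.surj_const_mult[of h] K.inj_on_cmult[of h] \<open>h \<in> K\<close>
        by (simp add: bij_betw_def)
    qed
    finally show "(\<rho> h * average n \<rho> K) $$ (i, j) = average n \<rho> K $$ (i, j)"
      using ij by (simp add: average_def)
  qed (use h in \<open>auto simp: average_def\<close>)
qed

text \<open>Dimensions of fixed-point subspaces are avoided: two projections with the same image
  satisfy \<open>A * B = B\<close> and \<open>B * A = A\<close>, hence have the same trace.\<close>

lemma trace_average_eq:
  assumes G: "group G" "finite (carrier G)" and \<rho>: "complex_representation G n \<rho>"
    and K: "subgroup K G" "subgroup M G" "K \<subseteq> M"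
    and fixed: "fixed_point_subspace n \<rho> K \<subseteq> fixed_point_subspace n \<rho> M"
  shows "trace (average n \<rho> K) = trace (average n \<rho> M)"
proof -
  let ?A = "average n \<rho>"
  have carr: "\<rho> g \<in> carrier_mat n n" if "g \<in> carrier G" for g
    using G \<rho> that by (auto simp: complex_representation_iff)
  have sub: "g \<in> carrier G" if "g \<in> K \<or> g \<in> M" for g
    using that K subgroup.mem_carrier by metis
  have fin: "finite K" "finite M" "K \<noteq> {}" "M \<noteq> {}"
    using sub G finite_subset[of _ "carrier G"] K subgroup.one_closed by blast+
  \<comment> \<open>The columns of \<open>?A K\<close> are fixed by \<open>K\<close>, hence by
    \<open>M\<close> according to \<open>fixed\<close>.\<close>
  have mult: "\<rho> m * ?A K = ?A K" if m: "m \<in> M" for m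
  proof (rule mat_col_eqI)
    fix j assume "j < dim_col (?A K)"
    then have j: "j < n" by (simp add: average_def)
    have "\<rho> k *\<^sub>v col (?A K) j = col (?A K) j" if "k \<in> K" for k
      using mult_average[OF G(1) \<rho> K(1) that] col_mult2[OF carr average_carrier j, of k] sub that
      by metis
    then have "col (?A K) j \<in> fixed_point_subspace n \<rho> K"
      using j by (simp add: fixed_point_subspace_def col_carrier_vec[OF _ average_carrier])
    then have "\<rho> m *\<^sub>v col (?A K) j = col (?A K) j"
      using fixed m by (auto simp: fixed_point_subspace_def)
    then show "col (\<rho> m * ?A K) j = col (?A K) j"
      using col_mult2[OF carr average_carrier j, of m \<rho> K] sub[of m] m by simp
  qed (use carr[of m] sub m in \<open>auto simp: average_def\<close>)
  have "?A M * ?A K = ?A K"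
    by (rule average_mult_fixed) (use fin carr sub mult in auto)
  \<comment> \<open>Here \<open>K \<subseteq> M\<close> enters: the columns of \<open>?A M\<close>
    are fixed by \<open>M\<close>, a fortiori by \<open>K\<close>.\<close>
  moreover have "?A K * ?A M = ?A M"
    by (rule average_mult_fixed) (use fin carr sub mult_average[OF G(1) \<rho> K(2)] K(3) in auto)
  ultimately show ?thesis
    using trace_mult_commute[of "?A M" n n "?A K"] by simp
qed


section \<open>Splitting a character along an invariant subspace\<close>

lemma sum_lessThan_split:
  fixes f :: "nat \<Rightarrow> 'a::comm_monoid_add"
  assumes "m \<le> n"
  shows "(\<Sum>i<n. f i) = (\<Sum>i<m. f i) + (\<Sum>i<n - m. f (i + m))"
proof -
  have "(\<Sum>i<m + k. f i) = (\<Sum>i<m. f i) + (\<Sum>i<k. f (i + m))" for k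
    by (induction k) (simp_all add: add_ac)
  from this[of "n - m"] assms show ?thesis by simp
qed

text \<open>In the basis given by \<open>P\<close> all matrices are block upper triangular, so the
  diagonal blocks multiply among themselves. The block \<open>\<alpha>\<close> is the action on the
  span of the first \<open>m\<close> basis vectors, \<open>\<delta>\<close> the action on the
  quotient, and the trace is the sum of the traces of both.\<close>

lemma complex_representation_split:
  assumes G: "group G" and \<rho>: "complex_representation G n \<rho>" and m: "m \<le> n"
    and P: "P \<in> carrier_mat n n" "Q \<in> carrier_mat n n" "P * Q = 1\<^sub>m n" "Q * P = 1\<^sub>m n"
    and zero: "\<And>g i j. g \<in> carrier G \<Longrightarrow> m \<le> i \<Longrightarrow> i < n \<Longrightarrow> j < m \<Longrightarrow>
      (Q * (\<rho> g * P)) $$ (i, j) = 0"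
  obtains \<alpha> \<delta> where "complex_representation G m \<alpha>" "complex_representation G (n - m) \<delta>"
    "\<And>g. g \<in> carrier G \<Longrightarrow> trace (\<rho> g) = trace (\<alpha> g) + trace (\<delta> g)"
proof -
  define \<sigma> where "\<sigma> g = Q * (\<rho> g * P)" for g
  interpret G: group G by fact
  have rho: "\<And>g. g \<in> carrier G \<Longrightarrow> \<rho> g \<in> carrier_mat n n" "\<rho> \<one>\<^bsub>G\<^esub> = 1\<^sub>m n"
    "\<And>g h. g \<in> carrier G \<Longrightarrow> h \<in> carrier G \<Longrightarrow> \<rho> (g \<otimes>\<^bsub>G\<^esub> h) = \<rho> g * \<rho> h"
    using \<rho> G by (auto simp: complex_representation_iff)
  have sigma: "\<sigma> g \<in> carrier_mat n n" if "g \<in> carrier G" for g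
    using rho(1)[OF that] P by (simp add: \<sigma>_def)
  have sigma_one: "\<sigma> \<one>\<^bsub>G\<^esub> = 1\<^sub>m n"
    using rho(2) P by (simp add: \<sigma>_def)
  have sigma_mult: "\<sigma> (g \<otimes>\<^bsub>G\<^esub> h) = \<sigma> g * \<sigma> h" if gh: "g \<in> carrier G" "h \<in> carrier G" for g h
  proof -
    note c = rho(1)[OF gh(1)] rho(1)[OF gh(2)] P(1,2)
    have "\<sigma> g * \<sigma> h = Q * (\<rho> g * (P * (Q * (\<rho> h * P))))"
      using c by (simp add: \<sigma>_def assoc_mult_mat[of _ n n _ n _ n])
    also have "P * (Q * (\<rho> h * P)) = \<rho> h * P"
      using c P(3) assoc_mult_mat[of P n n Q n "\<rho> h * P" n] by simp
    also have "Q * (\<rho> g * (\<rho> h * P)) = \<sigma> (g \<otimes>\<^bsub>G\<^esub> h)"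
      using c rho(3)[OF gh] by (simp add: \<sigma>_def assoc_mult_mat[of _ n n _ n _ n])
    finally show ?thesis by simp
  qed
  \<comment> \<open>Cutting the product at index \<open>m\<close> exhibits the blocks. For
    \<open>\<alpha>\<close> the second sum vanishes through its factor from
    \<open>\<sigma> h\<close>, for \<open>\<delta>\<close> the first one through its factor from
    \<open>\<sigma> g\<close>.\<close>
  have sigma_index: "\<sigma> (g \<otimes>\<^bsub>G\<^esub> h) $$ (i, j) = (\<Sum>l<m. \<sigma> g $$ (i, l) * \<sigma> h $$ (l, j))
      + (\<Sum>l<n - m. \<sigma> g $$ (i, l + m) * \<sigma> h $$ (l + m, j))"
    if "g \<in> carrier G" "h \<in> carrier G" "i < n" "j < n" for g h i j
    using that index_mult_mat_sum[OF sigma sigma, of g h i j]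
    by (simp add: sigma_mult sum_lessThan_split[OF m])
  define \<alpha> where "\<alpha> g = mat m m (\<lambda>(i, j). \<sigma> g $$ (i, j))" for g
  define \<delta> where "\<delta> g = mat (n - m) (n - m) (\<lambda>(i, j). \<sigma> g $$ (i + m, j + m))" for g
  have zero': "\<sigma> g $$ (i, j) = 0" if "g \<in> carrier G" "m \<le> i" "i < n" "j < m" for g i j
    using zero[OF that] by (simp add: \<sigma>_def)
  have mult_mat: "mat k k (\<lambda>(i, j). u i j) * mat k k (\<lambda>(i, j). v i j) =
      mat k k (\<lambda>(i, j). \<Sum>l<k. u i l * v l j)" for k and u v :: "nat \<Rightarrow> nat \<Rightarrow> complex"
    by (rule eq_matI) (auto simp: scalar_prod_def lessThan_atLeast0)
  show ?thesis
  proof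
    have "\<alpha> (g \<otimes>\<^bsub>G\<^esub> h) = \<alpha> g * \<alpha> h" if "g \<in> carrier G" "h \<in> carrier G" for g h
      unfolding \<alpha>_def mult_mat using that m
      by (intro eq_matI) (auto simp: sigma_index zero')
    moreover have "\<alpha> \<one>\<^bsub>G\<^esub> = 1\<^sub>m m"
      using m by (auto simp: \<alpha>_def sigma_one)
    ultimately show "complex_representation G m \<alpha>"
      using G by (auto simp: complex_representation_iff \<alpha>_def)
    have "\<delta> (g \<otimes>\<^bsub>G\<^esub> h) = \<delta> g * \<delta> h" if "g \<in> carrier G" "h \<in> carrier G" for g h
      unfolding \<delta>_def mult_mat using that m
      by (intro eq_matI) (auto simp: sigma_index zero')
    moreover have "\<delta> \<one>\<^bsub>G\<^esub> = 1\<^sub>m (n - m)"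
      using m by (auto simp: \<delta>_def sigma_one)
    ultimately show "complex_representation G (n - m) \<delta>"
      using G by (auto simp: complex_representation_iff \<delta>_def)
    fix g assume g: "g \<in> carrier G"
    have "trace (\<sigma> g) = trace ((\<rho> g * P) * Q)"
      unfolding \<sigma>_def using P rho(1)[OF g] by (intro trace_mult_commute[of _ n n]) auto
    also have "(\<rho> g * P) * Q = \<rho> g"
      using P rho(1)[OF g] by (simp add: assoc_mult_mat[of _ n n _ n _ n])
    finally have "trace (\<rho> g) = trace (\<sigma> g)" by simp
    also have "\<dots> = trace (\<alpha> g) + trace (\<delta> g)"
      using sigma[OF g] by (simp add: trace_def \<alpha>_def \<delta>_def sum_lessThan_split[OF m])
    finally show "trace (\<rho> g) = trace (\<alpha> g) + trace (\<delta> g)" .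
  qed
qed

text \<open>Induction on the dimension: a proper invariant subspace writes the character as a sum of
  two characters of smaller dimension, and additivity forces \<open>a\<close> to be nonzero at one
  of them. The assumption \<open>add\<close> compares functions on \<open>carrier G\<close> only,
  because \<open>\<rho>\<close> is unconstrained elsewhere.\<close>

lemma ex_irreducible_additive_nonzero:
  fixes a :: "('a \<Rightarrow> complex) \<Rightarrow> complex" and G :: "('a, 'b) monoid_scheme"
  assumes G: "group G"
    and add: "\<And>\<phi> \<chi> \<psi>. (\<And>g. g \<in> carrier G \<Longrightarrow> \<phi> g = \<chi> g + \<psi> g) \<Longrightarrow> a \<phi> = a \<chi> + a \<psi>"
    and \<rho>: "complex_representation G n \<rho>" "a (\<lambda>g. trace (\<rho> g)) \<noteq> 0"
  shows "\<exists>n \<rho>. irreducible_complex_representation G n \<rho> \<and> a (\<lambda>g. trace (\<rho> g)) \<noteq> 0"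
  using \<rho>
proof (induction n arbitrary: \<rho> rule: less_induct)
  case (less n)
  have rho: "\<rho> g \<in> carrier_mat n n" if "g \<in> carrier G" for g
    using less.prems(1) G that by (auto simp: complex_representation_iff)
  \<comment> \<open>In dimension 0 the character \<open>\<phi>\<close> vanishes on the group, so
    \<open>\<phi> = \<phi> + \<phi>\<close> there, which gives \<open>a \<phi> = 0\<close>.\<close>
  have "n \<noteq> 0"
  proof
    assume "n = 0"
    then have "trace (\<rho> g) = 0" if "g \<in> carrier G" for g
      using rho[OF that] by (simp add: trace_def)
    then show False
      using add[of "\<lambda>g. trace (\<rho> g)" "\<lambda>g. trace (\<rho> g)" "\<lambda>g. trace (\<rho> g)"] less.prems(2) by simp
  qed
  interpret vec_space "TYPE(complex)" n .
  show ?case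
  proof (cases "irreducible_complex_representation G n \<rho>")
    case True
    with less.prems show ?thesis by blast
  next
    case False
    then obtain W where W: "VectorSpace.subspace class_ring W V"
      "\<And>g w. g \<in> carrier G \<Longrightarrow> w \<in> W \<Longrightarrow> \<rho> g *\<^sub>v w \<in> W" "W \<noteq> {0\<^sub>v n}" "W \<noteq> carrier_vec n"
      using \<open>n \<noteq> 0\<close> less.prems(1) unfolding irreducible_complex_representation_def by blast
    from ex_adapted_basis[OF W(1)] obtain m P Q where m: "m \<le> n"
      and P: "P \<in> carrier_mat n n" "Q \<in> carrier_mat n n" "P * Q = 1\<^sub>m n" "Q * P = 1\<^sub>m n"
      and mem: "\<And>v. v \<in> W \<longleftrightarrow> v \<in> carrier_vec n \<and> (\<forall>i. m \<le> i \<and> i < n \<longrightarrow> (Q *\<^sub>v v) $ i = 0)"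
      by metis
    \<comment> \<open>Both \<open>m\<close> and \<open>n - m\<close> must be smaller than
      \<open>n\<close> for the induction; \<open>m = n\<close> would make \<open>W\<close> the whole
      space and \<open>m = 0\<close> would make it zero.\<close>
    have "m \<noteq> n" using mem W(4) by auto
    have "m \<noteq> 0"
    proof
      assume "m = 0"
      have "v = 0\<^sub>v n" if "v \<in> W" for v
      proof -
        have "Q *\<^sub>v v = 0\<^sub>v n"
          using mem that \<open>m = 0\<close> P by (intro eq_vecI) auto
        then have "P *\<^sub>v (Q *\<^sub>v v) = 0\<^sub>v n"
          using P by (auto intro!: eq_vecI)
        then show ?thesis
          using mem that P assoc_mult_mat_vec[of P n n Q n v] by simp
      qed
      moreover have "0\<^sub>v n \<in> W"
        using mem P by (auto simp: scalar_prod_def)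
      ultimately show False using W(3) by blast
    qed
    \<comment> \<open>For \<open>j < m\<close> the column \<open>col P j\<close> lies in
      \<open>W\<close>, and so does its image under \<open>\<rho> g\<close>; the coordinates of this
      image from \<open>m\<close> on are the entries in question.\<close>
    have zero: "(Q * (\<rho> g * P)) $$ (i, j) = 0"
      if g: "g \<in> carrier G" and i: "m \<le> i" "i < n" and j: "j < m" for g i j
    proof -
      have jn: "j < n" using j m by simp
      have "Q *\<^sub>v col P j = unit_vec n j"
        using col_mult2[OF P(2,1) jn] P(4) jn by simp
      then have "col P j \<in> W"
        unfolding mem using P i j jn by (auto simp del: index_mult_mat_vec)
      then have "\<rho> g *\<^sub>v col P j \<in> W"
        using W(2) g by blast
      then have "(Q *\<^sub>v (\<rho> g *\<^sub>v col P j)) $ i = 0"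
        using mem i by blast
      also have "Q *\<^sub>v (\<rho> g *\<^sub>v col P j) = col (Q * (\<rho> g * P)) j"
        using col_mult2[OF rho[OF g] P(1) jn] col_mult2[OF P(2) _ jn, of "\<rho> g * P"] rho[OF g] P
        by simp
      finally show ?thesis
        using i jn P rho[OF g] by simp
    qed
    obtain \<alpha> \<delta> where \<alpha>\<delta>: "complex_representation G m \<alpha>" "complex_representation G (n - m) \<delta>"
      and tr: "\<And>g. g \<in> carrier G \<Longrightarrow> trace (\<rho> g) = trace (\<alpha> g) + trace (\<delta> g)"
      by (rule complex_representation_split[OF G less.prems(1) m P]) (use zero in blast)+
    have "a (\<lambda>g. trace (\<alpha> g)) \<noteq> 0 \<or> a (\<lambda>g. trace (\<delta> g)) \<noteq> 0"
      using add[OF tr] less.prems(2) by auto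
    then show ?thesis
      using less.IH[of m \<alpha>] less.IH[of "n - m" \<delta>] \<alpha>\<delta> m \<open>m \<noteq> 0\<close> \<open>m \<noteq> n\<close> \<open>n \<noteq> 0\<close> by auto
  qed
qed

section \<open>The regular representation\<close>

text \<open>Left multiplication acts by permutation matrices on the elements numbered by
  \<open>e\<close>. The trace counts the solutions of \<open>g x = x\<close>, which are all elements
  if \<open>g\<close> is the identity and none otherwise.\<close>

lemma ex_regular_representation:
  assumes G: "group G" "finite (carrier G)"
  obtains n \<rho> where "complex_representation G n \<rho>"
    "\<And>g. g \<in> carrier G \<Longrightarrow> trace (\<rho> g) = (if g = \<one>\<^bsub>G\<^esub> then of_nat (card (carrier G)) else 0)"
proof -
  interpret G: group G by fact
  define n where "n = card (carrier G)"
  obtain e where e: "bij_betw e {0..<n} (carrier G)"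
    using ex_bij_betw_nat_finite[OF G(2)] n_def by blast
  have e_carrier: "e i \<in> carrier G" if "i < n" for i
    using e that by (auto simp: bij_betw_def)
  have e_eq: "e i = e j \<longleftrightarrow> i = j" if "i < n" "j < n" for i j
    using e that by (auto simp: bij_betw_def inj_on_def)
  define \<rho> where "\<rho> g = mat n n (\<lambda>(i, j). if e i = g \<otimes>\<^bsub>G\<^esub> e j then 1 else 0 :: complex)" for g
  have "\<rho> (g \<otimes>\<^bsub>G\<^esub> h) = \<rho> g * \<rho> h" if gh: "g \<in> carrier G" "h \<in> carrier G" for g h
  proof (rule eq_matI)
    fix i j assume "i < dim_row (\<rho> g * \<rho> h)" "j < dim_col (\<rho> g * \<rho> h)"
    then have ij: "i < n" "j < n" by (auto simp: \<rho>_def)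
    have "h \<otimes>\<^bsub>G\<^esub> e j \<in> e ` {0..<n}"
      using e e_carrier[OF ij(2)] gh by (simp add: bij_betw_def)
    \<comment> \<open>Only this index contributes to entry \<open>(i, j)\<close> of the product:
      column \<open>j\<close> of \<open>\<rho> h\<close> has its single 1 in row
      \<open>k\<close>.\<close>
    then obtain k where k: "k < n" "e k = h \<otimes>\<^bsub>G\<^esub> e j" by auto
    have "(\<rho> g * \<rho> h) $$ (i, j) = (\<Sum>l<n. \<rho> g $$ (i, l) * \<rho> h $$ (l, j))"
      using ij by (intro index_mult_mat_sum[of _ n n _ n]) (auto simp: \<rho>_def)
    also have "\<dots> = (\<Sum>l<n. if l = k then \<rho> g $$ (i, k) else 0)"
      using ij k by (intro sum.cong) (auto simp: \<rho>_def k(2)[symmetric] e_eq)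
    also have "\<dots> = \<rho> (g \<otimes>\<^bsub>G\<^esub> h) $$ (i, j)"
      using ij k gh e_carrier by (simp add: \<rho>_def G.m_assoc)
    finally show "\<rho> (g \<otimes>\<^bsub>G\<^esub> h) $$ (i, j) = (\<rho> g * \<rho> h) $$ (i, j)" by simp
  qed (auto simp: \<rho>_def)
  moreover have "\<rho> \<one>\<^bsub>G\<^esub> = 1\<^sub>m n"
    by (rule eq_matI) (auto simp: \<rho>_def e_carrier e_eq)
  ultimately have "complex_representation G n \<rho>"
    using G by (auto simp: complex_representation_iff \<rho>_def)
  moreover have "trace (\<rho> g) = (if g = \<one>\<^bsub>G\<^esub> then of_nat (card (carrier G)) else 0)"
    if g: "g \<in> carrier G" for g
  proof -
    have "e i = g \<otimes>\<^bsub>G\<^esub> e i \<longleftrightarrow> g = \<one>\<^bsub>G\<^esub>" if "i < n" for i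
      using G.r_cancel_one'[OF e_carrier[OF that] g] by auto
    then show ?thesis by (simp add: trace_def \<rho>_def n_def)
  qed
  ultimately show ?thesis using that by blast
qed

section \<open>Stabilizers of fixed-point subspaces and the conclusion\<close>

text \<open>This places stabilizers of fixed-point subspaces in the interval, where they can be
  compared with joins.\<close>

lemma subgroup_pointwise_stabilizer:
  assumes G: "group G" and \<rho>: "complex_representation G n \<rho>" and X: "X \<subseteq> carrier_vec n"
  shows "subgroup (pointwise_stabilizer G \<rho> X) G"
proof -
  interpret G: group G by fact
  have rho: "\<And>g. g \<in> carrier G \<Longrightarrow> \<rho> g \<in> carrier_mat n n" "\<rho> \<one>\<^bsub>G\<^esub> = 1\<^sub>m n"
    "\<And>g h. g \<in> carrier G \<Longrightarrow> h \<in> carrier G \<Longrightarrow> \<rho> (g \<otimes>\<^bsub>G\<^esub> h) = \<rho> g * \<rho> h"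
    using \<rho> G by (auto simp: complex_representation_iff)
  have mult: "\<rho> (g \<otimes>\<^bsub>G\<^esub> h) *\<^sub>v x = \<rho> g *\<^sub>v (\<rho> h *\<^sub>v x)"
    if "g \<in> carrier G" "h \<in> carrier G" "x \<in> X" for g h x
    using that rho(3) X assoc_mult_mat_vec[OF rho(1) rho(1)] by auto
  show ?thesis
  proof
    show "\<one>\<^bsub>G\<^esub> \<in> pointwise_stabilizer G \<rho> X"
      using rho(2) X by (auto simp: pointwise_stabilizer_def)
    fix g assume g: "g \<in> pointwise_stabilizer G \<rho> X"
    have "\<rho> (inv\<^bsub>G\<^esub> g) *\<^sub>v x = x" if x: "x \<in> X" for x
    proof -
      have "\<rho> (inv\<^bsub>G\<^esub> g) *\<^sub>v x = \<rho> (inv\<^bsub>G\<^esub> g) *\<^sub>v (\<rho> g *\<^sub>v x)"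
        using g x by (simp add: pointwise_stabilizer_def)
      also have "\<dots> = \<rho> (inv\<^bsub>G\<^esub> g \<otimes>\<^bsub>G\<^esub> g) *\<^sub>v x"
        using g x mult[of "inv\<^bsub>G\<^esub> g" g x] by (simp add: pointwise_stabilizer_def del: G.l_inv)
      also have "\<dots> = x"
        using g x X rho(2) by (auto simp: pointwise_stabilizer_def)
      finally show ?thesis .
    qed
    then show "inv\<^bsub>G\<^esub> g \<in> pointwise_stabilizer G \<rho> X"
      using g by (simp add: pointwise_stabilizer_def)
  qed (auto simp: pointwise_stabilizer_def mult)
qed

theorem theorem1p4:
  fixes G :: "('a, 'b) monoid_scheme" and H :: "'a set"
  assumes "group G"
    and "finite (carrier G)"
    and "subgroup H G"
    and "distributive_lattice (subgroup_interval H G)"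
    and "dual_euler_totient H G \<noteq> 0"
  shows "\<exists>n \<rho>. irreducible_complex_representation G n \<rho> \<and>
    pointwise_stabilizer G \<rho> (fixed_point_subspace n \<rho> H) = H"
proof -
  interpret G: group G by fact
  define L where "L = subgroup_interval H G"
  interpret L: lattice L
    using assms(4) by (simp add: distributive_lattice_def L_def)
  have carrier_L: "K \<in> carrier L \<longleftrightarrow> subgroup K G \<and> H \<subseteq> K" for K
    by (simp add: L_def subgroup_interval_def)
  have le_L: "K \<sqsubseteq>\<^bsub>L\<^esub> M \<longleftrightarrow> K \<subseteq> M" for K M
    by (simp add: L_def subgroup_interval_def)
  have fin_L: "finite (carrier L)"
    by (rule finite_subset[of _ "Pow (carrier G)"])
      (use assms(2) in \<open>auto simp: carrier_L subgroup.mem_carrier\<close>)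
  have fin: "finite K" if "K \<in> carrier L" for K
    using that finite_subset[OF subgroup.subset assms(2)] by (simp add: carrier_L)
  define a where "a \<chi> = (\<Sum>K\<in>carrier L. of_int (mobius L H K) * ((\<Sum>k\<in>K. \<chi> k) / of_nat (card K)))"
    for \<chi> :: "'a \<Rightarrow> complex"
  have a_add: "a \<phi> = a \<chi> + a \<psi>" if *: "\<And>g. g \<in> carrier G \<Longrightarrow> \<phi> g = \<chi> g + \<psi> g" for \<phi> \<chi> \<psi>
  proof -
    have "(\<Sum>k\<in>K. \<phi> k) = (\<Sum>k\<in>K. \<chi> k) + (\<Sum>k\<in>K. \<psi> k)" if "K \<in> carrier L" for K
      unfolding sum.distrib[symmetric]
      by (intro sum.cong refl *) (use that in \<open>auto simp: carrier_L subgroup.mem_carrier\<close>)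
    then have "a \<phi> = (\<Sum>K\<in>carrier L. of_int (mobius L H K) *
        (((\<Sum>k\<in>K. \<chi> k) + (\<Sum>k\<in>K. \<psi> k)) / of_nat (card K)))"
      unfolding a_def by (intro sum.cong) auto
    then show ?thesis
      by (simp add: a_def sum.distrib add_divide_distrib distrib_left)
  qed
  obtain n0 \<rho>0 where reg: "complex_representation G n0 \<rho>0"
    and tr: "\<And>g. g \<in> carrier G \<Longrightarrow>
      trace (\<rho>0 g) = (if g = \<one>\<^bsub>G\<^esub> then of_nat (card (carrier G)) else 0)"
    using ex_regular_representation[OF assms(1,2)] by metis
  have "a (\<lambda>g. trace (\<rho>0 g)) = of_int (dual_euler_totient H G)"
  proof -
    \<comment> \<open>The regular character is the group order at the identity and 0 elsewhere, so
      by Lagrange its average over \<open>K\<close> is the index of \<open>K\<close>.\<close>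
    have "(\<Sum>k\<in>K. trace (\<rho>0 k)) / of_nat (card K) = of_nat (card (rcosets\<^bsub>G\<^esub> K))"
      if K: "K \<in> carrier L" for K
    proof -
      have sub: "subgroup K G" and "\<one>\<^bsub>G\<^esub> \<in> K"
        using K subgroup.one_closed by (auto simp: carrier_L)
      have "(\<Sum>k\<in>K. trace (\<rho>0 k)) = (\<Sum>k\<in>K. if k = \<one>\<^bsub>G\<^esub> then of_nat (card (carrier G)) else 0)"
        by (intro sum.cong refl tr) (use sub in \<open>auto simp: subgroup.mem_carrier\<close>)
      also have "\<dots> = of_nat (card (rcosets\<^bsub>G\<^esub> K) * card K)"
        using G.lagrange[OF sub] fin[OF K] \<open>\<one>\<^bsub>G\<^esub> \<in> K\<close> by (simp add: Coset.order_def)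
      finally show ?thesis
        using fin[OF K] \<open>\<one>\<^bsub>G\<^esub> \<in> K\<close> by auto
    qed
    then show ?thesis
      by (simp add: a_def dual_euler_totient_def L_def[symmetric])
  qed
  then have "a (\<lambda>g. trace (\<rho>0 g)) \<noteq> 0"
    using assms(5) by simp
  from ex_irreducible_additive_nonzero[where a = a, OF assms(1) a_add reg this]
  obtain n \<rho> where irr: "irreducible_complex_representation G n \<rho>"
    and nz: "a (\<lambda>g. trace (\<rho> g)) \<noteq> 0" by blast
  then have \<rho>: "complex_representation G n \<rho>"
    by (simp add: irreducible_complex_representation_def)
  let ?M = "pointwise_stabilizer G \<rho> (fixed_point_subspace n \<rho> H)"
  have stab: "subgroup (pointwise_stabilizer G \<rho> (fixed_point_subspace n \<rho> K)) G" for K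
    by (rule subgroup_pointwise_stabilizer[OF assms(1) \<rho>]) (auto simp: fixed_point_subspace_def)
  have K_stab: "K \<subseteq> pointwise_stabilizer G \<rho> (fixed_point_subspace n \<rho> K)" if "subgroup K G" for K
    using that subgroup.mem_carrier
    by (fastforce simp: pointwise_stabilizer_def fixed_point_subspace_def)
  have M: "?M \<in> carrier L"
    using stab K_stab assms(3) by (simp add: carrier_L)
  have H: "H \<in> carrier L"
    using assms(3) by (simp add: carrier_L)
  have "?M = H"
  proof (rule ccontr)
    assume "?M \<noteq> H"
    \<comment> \<open>The stabilizer \<open>?T\<close> of the vectors fixed by \<open>K\<close>
      contains \<open>K\<close>, and also \<open>?M\<close>, since these vectors are fixed by
      \<open>H\<close>. As a member of the interval it contains the join, so passing from
      \<open>K\<close> to the join loses no fixed vectors.\<close>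
    have "trace (average n \<rho> (K \<squnion>\<^bsub>L\<^esub> ?M)) = trace (average n \<rho> K)" if K: "K \<in> carrier L" for K
    proof (rule trace_average_eq[OF assms(1,2) \<rho>, symmetric])
      let ?T = "pointwise_stabilizer G \<rho> (fixed_point_subspace n \<rho> K)"
      have "fixed_point_subspace n \<rho> K \<subseteq> fixed_point_subspace n \<rho> H"
        using K by (auto simp: carrier_L fixed_point_subspace_def)
      then have "?M \<subseteq> ?T"
        by (auto simp: pointwise_stabilizer_def)
      moreover have "K \<subseteq> ?T" "?T \<in> carrier L"
        using K K_stab stab by (auto simp: carrier_L)
      ultimately have "K \<squnion>\<^bsub>L\<^esub> ?M \<subseteq> ?T"
        using L.join_le[of K ?T ?M] K M by (simp add: le_L)
      then show "fixed_point_subspace n \<rho> K \<subseteq> fixed_point_subspace n \<rho> (K \<squnion>\<^bsub>L\<^esub> ?M)"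
        by (auto simp: pointwise_stabilizer_def fixed_point_subspace_def)
      show "subgroup K G" "subgroup (K \<squnion>\<^bsub>L\<^esub> ?M) G" "K \<subseteq> K \<squnion>\<^bsub>L\<^esub> ?M"
        using K M L.join_closed[of K ?M] L.join_left[of K ?M] by (auto simp: carrier_L le_L)
    qed
    \<comment> \<open>Weisner's theorem applies with bottom element \<open>H\<close> and
      \<open>?M\<close> as the element joined. The sum is the value of \<open>a\<close> at the
      character of \<open>\<rho>\<close>, which was chosen nonzero.\<close>
    then have "(\<Sum>K\<in>carrier L. of_int (mobius L H K) * trace (average n \<rho> K)) = 0"
      using L.weisner[OF fin_L H _ M \<open>?M \<noteq> H\<close>, of "\<lambda>K. trace (average n \<rho> K)"]
      by (simp add: carrier_L le_L)
    moreover have "trace (average n \<rho> K) = (\<Sum>k\<in>K. trace (\<rho> k)) / of_nat (card K)"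
      if "K \<in> carrier L" for K
      using that assms(1) \<rho>
      by (intro trace_average) (auto simp: carrier_L complex_representation_iff subgroup.mem_carrier)
    ultimately show False
      using nz by (simp add: a_def)
  qed
  with irr show ?thesis by blast
qed

end
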